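(* Let $k$ be a field and let $d\ge 1$. Then for every $(d-1)$-element subset $\overline{\alpha}\subset\{1,\dots,2d-1\}$, $$d!\cdot A'_{\overline{\alpha}}\in I_d(d,2d-1).$$
   Context: The permanent of an $n\times n$ matrix $(a_{i,j})$ over a commutative ring is $\sum_{\sigma\in S_n}a_{1,\sigma(1)}\cdots a_{n,\sigma(n)}$ (the permanent of the empty matrix is $1$). For a field $k$, $M_{d,2d-1}=(x_{i,j})$ is the generic $d\times(2d-1)$ matrix of independent indeterminates over $k$, and $I_d(d,2d-1)\subset k[x_{i,j}]$ is the ideal generated by the permanents of all $d\times d$ submatrices of $M_{d,2d-1}$. For a strictly increasing sequence (equivalently, a subset) $\overline{\alpha}=(\alpha_1,\dots,\alpha_{d-1})$ of elements of $\{1,\dots,2d-1\}$, let $A_{\overline{\alpha}}$ be the permanent of the $(d-1)\times(d-1)$ submatrix of $M_{d,2d-1}$ obtained by omitting the first row and taking the columns $\alpha_1,\dots,\alpha_{d-1}$, and put $$A'_{\overline{\alpha}}=A_{\overline{\alpha}}\cdot\prod_{i\in\{1,\dots,2d-1\}\setminus\overline{\alpha}}x_{1,i}.$$ *)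

theory Defs
  imports
    "HOL-Library.Poly_Mapping"
    "HOL-Algebra.Ideal"
    "Jordan_Normal_Form.DL_Submatrix"
begin

text \<open>By convention the value for a non-square matrix is the dummy \<open>0\<close>.\<close>

definition permanent :: "'a::comm_ring_1 mat \<Rightarrow> 'a" where
  "permanent A = (if dim_row A = dim_col A
     then \<Sum>p | p permutes {0..<dim_row A}. \<Prod>i = 0..<dim_row A. A $$ (i, p i)
     else 0)"

lemma permanent_empty: "dim_row A = 0 \<Longrightarrow> dim_col A = 0 \<Longrightarrow> permanent A = 1"
  by (simp add: permanent_def)

text \<open>Polynomials over \<open>'k\<close> with indeterminates of type \<open>'v\<close>: finitely supported maps from
  monomials (finitely supported exponent functions) to coefficients.\<close>

type_synonym ('v, 'k) mpoly = "('v \<Rightarrow>\<^sub>0 nat) \<Rightarrow>\<^sub>0 'k"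

definition var :: "'v \<Rightarrow> ('v, 'k::comm_ring_1) mpoly" where
  "var v = Poly_Mapping.single (Poly_Mapping.single v 1) 1"

definition poly_ring :: "'v set \<Rightarrow> ('v, 'k::comm_ring_1) mpoly ring" where
  "poly_ring V =
     \<lparr>carrier = {p. \<forall>m \<in> Poly_Mapping.keys p. Poly_Mapping.keys m \<subseteq> V},
      monoid.mult = (*), one = 1, zero = 0, add = (+)\<rparr>"

lemma poly_ring_simps [simp]:
  "x \<oplus>\<^bsub>poly_ring V\<^esub> y = x + y" "x \<otimes>\<^bsub>poly_ring V\<^esub> y = x * y"
  "\<zero>\<^bsub>poly_ring V\<^esub> = 0" "\<one>\<^bsub>poly_ring V\<^esub> = 1"
  by (simp_all add: poly_ring_def)

lemma zero_in_poly_ring: "0 \<in> carrier (poly_ring V)"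
  and one_in_poly_ring: "1 \<in> carrier (poly_ring V)"
  by (auto simp: poly_ring_def)

lemma add_in_poly_ring:
  "p \<in> carrier (poly_ring V) \<Longrightarrow> q \<in> carrier (poly_ring V) \<Longrightarrow> p + q \<in> carrier (poly_ring V)"
  using Poly_Mapping.keys_add[of p q] by (auto simp: poly_ring_def)

lemma mult_in_poly_ring:
  assumes "p \<in> carrier (poly_ring V)" "q \<in> carrier (poly_ring V)"
  shows "p * q \<in> carrier (poly_ring V)"
proof -
  have "Poly_Mapping.keys m \<subseteq> V" if m: "m \<in> Poly_Mapping.keys (p * q)" for m
  proof -
    obtain a b where "m = a + b" "a \<in> Poly_Mapping.keys p" "b \<in> Poly_Mapping.keys q"
      using m keys_mult[of p q] by blast
    moreover have "Poly_Mapping.keys (a + b) \<subseteq> Poly_Mapping.keys a \<union> Poly_Mapping.keys b"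
      by (rule Poly_Mapping.keys_add)
    ultimately show ?thesis
      using assms by (auto simp: poly_ring_def)
  qed
  then show ?thesis
    by (simp add: poly_ring_def)
qed

lemma uminus_in_poly_ring: "p \<in> carrier (poly_ring V) \<Longrightarrow> - p \<in> carrier (poly_ring V)"
  by (simp add: poly_ring_def)

lemma cring_poly_ring:
  fixes V :: "'v set"
  shows "cring (poly_ring V :: ('v, 'k::comm_ring_1) mpoly ring)"
proof (rule cringI)
  show "abelian_group (poly_ring V :: ('v, 'k) mpoly ring)"
  proof (rule abelian_groupI)
    fix x :: "('v, 'k) mpoly" assume "x \<in> carrier (poly_ring V)"
    then show "\<exists>y\<in>carrier (poly_ring V). y \<oplus>\<^bsub>poly_ring V\<^esub> x = \<zero>\<^bsub>poly_ring V\<^esub>"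
      by (intro bexI[of _ "- x"] uminus_in_poly_ring) simp_all
  qed (simp_all add: zero_in_poly_ring add_in_poly_ring add_ac)
next
  show "Group.comm_monoid (poly_ring V :: ('v, 'k) mpoly ring)"
    by (rule comm_monoidI) (simp_all add: one_in_poly_ring mult_in_poly_ring mult_ac)
qed (simp add: distrib_right)

lemma var_in_poly_ring: "v \<in> V \<Longrightarrow> var v \<in> carrier (poly_ring V)"
  by (simp add: poly_ring_def var_def)

lemma sum_in_poly_ring:
  "(\<And>i. i \<in> A \<Longrightarrow> f i \<in> carrier (poly_ring V)) \<Longrightarrow> sum f A \<in> carrier (poly_ring V)"
  by (induction A rule: infinite_finite_induct) (auto intro: zero_in_poly_ring add_in_poly_ring)

lemma prod_in_poly_ring:
  "(\<And>i. i \<in> A \<Longrightarrow> f i \<in> carrier (poly_ring V)) \<Longrightarrow> prod f A \<in> carrier (poly_ring V)"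
  by (induction A rule: infinite_finite_induct) (auto intro: one_in_poly_ring mult_in_poly_ring)

text \<open>Rows, columns and the indices of the indeterminates are numbered from \<open>0\<close>, as usual
  for \<^typ>\<open>'a mat\<close>; the first row is row \<open>0\<close>.\<close>

definition generic_mat :: "nat \<Rightarrow> nat \<Rightarrow> (nat \<times> nat, 'k::comm_ring_1) mpoly mat" where
  "generic_mat m n = mat m n var"

abbreviation generic_ring :: "nat \<Rightarrow> nat \<Rightarrow> (nat \<times> nat, 'k::comm_ring_1) mpoly ring" where
  "generic_ring m n \<equiv> poly_ring ({..<m} \<times> {..<n})"

definition subpermanents :: "nat \<Rightarrow> nat \<Rightarrow> nat \<Rightarrow> (nat \<times> nat, 'k::comm_ring_1) mpoly set" where
  "subpermanents r m n = {permanent (submatrix (generic_mat m n) I J) | I J.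
     I \<subseteq> {..<m} \<and> card I = r \<and> J \<subseteq> {..<n} \<and> card J = r}"

definition permanental_ideal :: "nat \<Rightarrow> nat \<Rightarrow> nat \<Rightarrow> (nat \<times> nat, 'k::comm_ring_1) mpoly set" where
  "permanental_ideal r m n = Idl\<^bsub>generic_ring m n\<^esub> (subpermanents r m n)"

text \<open>The generators lie in the carrier, so the intersection in \<^const>\<open>genideal\<close> is not
  over an empty family.\<close>

lemma permanent_submatrix_in_generic_ring:
  "permanent (submatrix (generic_mat m n) I J) \<in> carrier (generic_ring m n)"
proof -
  let ?S = "submatrix (generic_mat m n) I J :: (nat \<times> nat, 'a) mpoly mat"
  have "?S $$ (i, j) \<in> carrier (generic_ring m n)" if "i < dim_row ?S" "j < dim_col ?S" for i j
  proof -
    have "pick I i < m" "pick J j < n"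
      using that pick_le by (auto simp: dim_submatrix generic_mat_def)
    moreover from this have "?S $$ (i, j) = var (pick I i, pick J j)"
      using that submatrix_index[of i "generic_mat m n" I j J]
      by (simp add: dim_submatrix generic_mat_def)
    ultimately show ?thesis
      using var_in_poly_ring[of "(pick I i, pick J j)" "{..<m} \<times> {..<n}"] by simp
  qed
  then show ?thesis
    unfolding permanent_def
    by (auto intro!: sum_in_poly_ring prod_in_poly_ring zero_in_poly_ring
        dest: permutes_in_image[THEN iffD2])
qed

lemma subpermanents_subset: "subpermanents r m n \<subseteq> carrier (generic_ring m n)"
  by (auto simp: subpermanents_def permanent_submatrix_in_generic_ring)

lemma ideal_permanental_ideal: "ideal (permanental_ideal r m n) (generic_ring m n)"
  unfolding permanental_ideal_def
  by (intro ring.genideal_ideal cring.axioms(1) cring_poly_ring subpermanents_subset)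

definition A_poly :: "nat \<Rightarrow> nat set \<Rightarrow> (nat \<times> nat, 'k::comm_ring_1) mpoly" where
  "A_poly d \<alpha> = permanent (submatrix (generic_mat d (2 * d - 1)) {1..<d} \<alpha>)"

definition A'_poly :: "nat \<Rightarrow> nat set \<Rightarrow> (nat \<times> nat, 'k::comm_ring_1) mpoly" where
  "A'_poly d \<alpha> = A_poly d \<alpha> * (\<Prod>i\<in>{..<2 * d - 1} - \<alpha>. var (0, i))"

end

theory Submission
  imports Defs
begin

text \<open>Expanding the permanent of the columns \<open>J\<close>, \<open>card J = d\<close>, along the first row and
  multiplying by the first row entries outside \<open>J\<close> gives the sum of the \<open>A'\<^sub>\<beta>\<close> over the
  \<open>(d-1)\<close>-subsets \<open>\<beta>\<close> of \<open>J\<close>, so all these sums lie in the ideal. The inclusion matrix of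
  \<open>(d-1)\<close>-subsets in \<open>d\<close>-subsets of a \<open>(2d-1)\<close>-set has, up to the factor \<open>d!\<close>, an integral
  inverse: weighting \<open>J\<close> by \<open>c\<^sub>s = (-1)\<^bsup>s-1\<^esup> (s-1)! (d-s)!\<close>, where \<open>s = card (J - \<alpha>)\<close>, makes
  the coefficient of \<open>A'\<^sub>\<beta>\<close> with \<open>s = card (\<beta> - \<alpha>)\<close> equal to \<open>s c\<^sub>s + (d - s) c\<^sub>s\<^sub>+\<^sub>1\<close>,
  which is \<open>d!\<close> for \<open>\<beta> = \<alpha>\<close> and vanishes otherwise.\<close>

section \<open>Permanents with rows and columns indexed by sets\<close>

text \<open>Extensionality fixes the values off \<open>I\<close>, so that each bijection from
  \<open>I\<close> to \<open>J\<close> is one function and is counted once.\<close>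

definition bijections :: "'a set \<Rightarrow> 'b set \<Rightarrow> ('a \<Rightarrow> 'b) set" where
  "bijections I J = {g \<in> extensional I. bij_betw g I J}"

text \<open>Indexing by sets turns the deletion of a column into \<open>J - {j}\<close>, with no
  renumbering through \<open>pick\<close>.\<close>

definition set_permanent :: "'a set \<Rightarrow> 'b set \<Rightarrow> ('a \<Rightarrow> 'b \<Rightarrow> 'c::comm_ring_1) \<Rightarrow> 'c" where
  "set_permanent I J f = (\<Sum>g\<in>bijections I J. \<Prod>i\<in>I. f i (g i))"

lemma finite_bijections:
  assumes "finite I" "finite J"
  shows "finite (bijections I J)"
proof (rule finite_subset)
  show "bijections I J \<subseteq> I \<rightarrow>\<^sub>E J"
    by (auto simp: bijections_def PiE_def dest: bij_betwE)
  show "finite (I \<rightarrow>\<^sub>E J)"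
    using assms by (intro finite_PiE) auto
qed

text \<open>Enumerations \<open>a\<close> and \<open>b\<close> turn a permutation \<open>p\<close>
  into the bijection \<open>b\<close> after \<open>p\<close> after the inverse of \<open>a\<close>.
  The map back is the identity off \<open>{0..<n}\<close>, as \<open>permutes\<close>
  demands.\<close>

lemma sum_permutes_eq_set_permanent:
  fixes n :: nat
  assumes a: "bij_betw a {0..<n} I" and b: "bij_betw b {0..<n} J"
  shows "(\<Sum>p | p permutes {0..<n}. \<Prod>k = 0..<n. f (a k) (b (p k))) = set_permanent I J f"
  unfolding set_permanent_def
proof (rule sum.reindex_bij_witness[where
      i = "\<lambda>g k. if k < n then inv_into {0..<n} b (g (a k)) else k" and
      j = "\<lambda>p. restrict (\<lambda>i. b (p (inv_into {0..<n} a i))) I"], goal_cases)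
  case (1 p)
  have "p k < n" if "k < n" for k
    using 1 that permutes_in_image[of p "{0..<n}" k] by simp
  moreover have "p k = k" if "\<not> k < n" for k
    using 1 that by (auto simp: permutes_def)
  ultimately show ?case
    using a b by (auto simp: fun_eq_iff bij_betw_inv_into_left bij_betwE)
next
  case (2 p)
  have "bij_betw (b \<circ> p \<circ> inv_into {0..<n} a) I J"
    using 2 a b by (metis (no_types) bij_betw_trans bij_betw_inv_into permutes_imp_bij mem_Collect_eq)
  then show ?case
    by (simp add: bijections_def o_def cong: bij_betw_cong)
next
  case (3 g)
  then have g: "g \<in> extensional I" "bij_betw g I J"
    by (auto simp: bijections_def)
  have "g i = b (inv_into {0..<n} b (g i))" "inv_into {0..<n} a i < n"
    "a (inv_into {0..<n} a i) = i" if "i \<in> I" for i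
    using that a b g bij_betwE[OF bij_betw_inv_into[OF a]]
    by (auto simp: bij_betw_inv_into_right bij_betwE)
  then show ?case
    using g(1) by (auto simp: fun_eq_iff extensional_def)
next
  case (4 g)
  then have g: "bij_betw g I J"
    by (auto simp: bijections_def)
  have "bij_betw (inv_into {0..<n} b \<circ> g \<circ> a) {0..<n} {0..<n}"
    using a b g by (intro bij_betw_trans bij_betw_inv_into) auto
  then have "bij_betw (\<lambda>k. if k < n then inv_into {0..<n} b (g (a k)) else k) {0..<n} {0..<n}"
    by (rule bij_betw_cong[THEN iffD1, rotated]) auto
  then show ?case
    by (auto intro!: bij_imp_permutes)
next
  case (5 p)
  show ?case
    by (rule prod.reindex_bij_betw[OF a, symmetric, THEN trans])
      (use a in \<open>auto intro!: prod.cong simp: bij_betw_inv_into_left bij_betwE\<close>)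
qed

lemma bij_betw_pick:
  assumes "finite I"
  shows "bij_betw (pick I) {0..<card I} I"
proof -
  have inj: "inj_on (pick I) {0..<card I}"
    by (rule linorder_inj_onI) (use pick_mono_le[of _ I] in force)+
  moreover have "pick I ` {0..<card I} = I"
  proof (rule card_subset_eq[OF assms])
    show "pick I ` {0..<card I} \<subseteq> I"
      by (auto intro: pick_in_set_le)
    show "card (pick I ` {0..<card I}) = card I"
      using inj by (simp add: card_image)
  qed
  ultimately show ?thesis
    by (simp add: bij_betw_def)
qed

text \<open>The increasing enumerations \<open>pick I\<close> and \<open>pick J\<close> serve as
  \<open>a\<close> and \<open>b\<close> in \<open>sum_permutes_eq_set_permanent\<close>.\<close>

lemma permanent_submatrix:
  assumes I: "I \<subseteq> {..<dim_row A}" and J: "J \<subseteq> {..<dim_col A}" and card: "card I = card J"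
  shows "permanent (submatrix A I J) = set_permanent I J (\<lambda>i j. A $$ (i, j))"
proof -
  let ?n = "card I"
  have fin: "finite I" "finite J"
    using I J finite_subset by blast+
  have eq: "{i. i < dim_row A \<and> i \<in> I} = I" "{j. j < dim_col A \<and> j \<in> J} = J"
    using I J by auto
  have dim: "dim_row (submatrix A I J) = ?n" "dim_col (submatrix A I J) = ?n"
    using card by (simp_all add: dim_submatrix eq)
  have "permanent (submatrix A I J)
      = (\<Sum>p | p permutes {0..<?n}. \<Prod>k = 0..<?n. A $$ (pick I k, pick J (p k)))"
    unfolding permanent_def dim
  proof (simp, intro sum.cong prod.cong refl)
    fix p k assume "p \<in> {p. p permutes {0..<?n}}" and k: "k \<in> {0..<?n}"
    then have "p k < ?n"
      using permutes_in_image[of p "{0..<?n}" k] by auto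
    then show "submatrix A I J $$ (k, p k) = A $$ (pick I k, pick J (p k))"
      using k card by (intro submatrix_index) (simp_all add: eq)
  qed
  also have "\<dots> = set_permanent I J (\<lambda>i j. A $$ (i, j))"
    by (rule sum_permutes_eq_set_permanent) (use fin card bij_betw_pick in metis)+
  finally show ?thesis .
qed

text \<open>Laplace expansion along row \<open>r\<close>: the bijections \<open>g\<close> are sorted
  by \<open>j = g r\<close>, and the rest of \<open>g\<close> is a bijection from \<open>I\<close>
  to \<open>J - {j}\<close>.\<close>

lemma set_permanent_insert:
  assumes "finite I" "finite J" "r \<notin> I"
  shows "set_permanent (insert r I) J f = (\<Sum>j\<in>J. f r j * set_permanent I (J - {j}) f)"
proof -
  have "set_permanent (insert r I) J f
      = (\<Sum>(j, h)\<in>(SIGMA j:J. bijections I (J - {j})). f r j * (\<Prod>i\<in>I. f i (h i)))"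
    unfolding set_permanent_def
  proof (rule sum.reindex_bij_witness[where
        i = "\<lambda>(j, h). h(r := j)" and j = "\<lambda>g. (g r, restrict g I)"], goal_cases)
    case (1 g)
    then show ?case
      using assms(3) by (auto simp: bijections_def fun_eq_iff extensional_def)
  next
    case (2 g)
    then have g: "bij_betw g (insert r I) J"
      by (simp add: bijections_def)
    then have "bij_betw g I (J - {g r})"
      using assms(3) by (auto simp: bij_betw_def inj_on_def)
    then show ?case
      using g by (auto simp: bijections_def bij_betw_def cong: inj_on_cong)
  next
    case (3 x)
    then show ?case
      using assms(3) by (auto simp: bijections_def fun_eq_iff extensional_def)
  next
    case (4 x)
    then obtain j h where x: "x = (j, h)" "j \<in> J" "h \<in> extensional I" "bij_betw h I (J - {j})"
      by (auto simp: bijections_def)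
    have "bij_betw (h(r := j)) I (J - {j})"
      using x(4) assms(3) by (subst bij_betw_cong[of I _ h]) auto
    then have "bij_betw (h(r := j)) (insert r I) J"
      using notIn_Un_bij_betw[of r I "h(r := j)" "J - {j}"] assms(3) x(2)
      by (simp add: insert_absorb)
    then show ?case
      using x by (auto simp: bijections_def extensional_def)
  next
    case (5 g)
    then show ?case
      using assms by simp
  qed
  also have "\<dots> = (\<Sum>j\<in>J. f r j * set_permanent I (J - {j}) f)"
    using assms by (subst sum.Sigma[symmetric])
      (simp_all add: finite_bijections set_permanent_def sum_distrib_left)
  finally show ?thesis .
qed

section \<open>Inverting the inclusion matrix up to the factor d!\<close>

text \<open>For 1 \<le> s \<le> d this is (-1)^(s-1) (d-1)! divided by the binomial coefficient of
  d-1 over s-1. A d-set \<open>J\<close> is larger than \<alpha>, so it has s \<ge> 1; the value at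
  s = 0 enters only with the factor 0.\<close>

definition weight :: "nat \<Rightarrow> nat \<Rightarrow> int" where
  "weight d s = (-1) ^ (s - 1) * fact (s - 1) * fact (d - s)"

text \<open>For s > 0 the two terms are s! (d-s)! with opposite signs; for s = 0 only d (d-1)!
  remains.\<close>

lemma weight_cancel:
  assumes "s < d"
  shows "int s * weight d s + int (d - s) * weight d (Suc s) = (if s = 0 then fact d else 0)"
proof -
  \<comment> \<open>Now \<open>d - s\<close> is \<open>Suc m\<close> and \<open>d - Suc s\<close> is
    \<open>m\<close>, so the factorials unfold without truncated subtraction.\<close>
  obtain m where m: "d = Suc (s + m)"
    using assms less_imp_Suc_add by blast
  show ?thesis
    by (cases s) (simp_all add: weight_def m algebra_simps)
qed

text \<open>Adding an element of \<alpha> to \<beta> keeps s =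
  \<open>card (\<beta> - \<alpha>)\<close>, adding any other element raises it by one. Among the d
  elements of \<open>X - \<beta>\<close> there are s of the first sort and d - s of the
  second.\<close>

lemma sum_weight:
  assumes X: "finite X" "card X = 2 * d - 1"
    and \<alpha>: "\<alpha> \<subseteq> X" "card \<alpha> = d - 1" and \<beta>: "\<beta> \<subseteq> X" "card \<beta> = d - 1" and "d \<ge> 1"
  shows "(\<Sum>i\<in>X - \<beta>. weight d (card (insert i \<beta> - \<alpha>))) = (if \<beta> = \<alpha> then fact d else 0)"
proof -
  let ?s = "card (\<beta> - \<alpha>)"
  have fin: "finite \<alpha>" "finite \<beta>"
    using X(1) \<alpha>(1) \<beta>(1) finite_subset by blast+
  have s: "?s < d"
    using card_mono[of \<beta> "\<beta> - \<alpha>"] fin \<beta>(2) \<open>d \<ge> 1\<close> by auto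
  \<comment> \<open>Both sides equal d - 1, the common size of \<alpha> and \<beta>.\<close>
  have "card (\<alpha> - \<beta>) + card (\<alpha> \<inter> \<beta>) = card (\<beta> - \<alpha>) + card (\<alpha> \<inter> \<beta>)"
    using fin \<alpha>(2) \<beta>(2) by (metis card_Diff_subset_Int card_Int_Diff inf_commute add.commute)
  then have 1: "card (\<alpha> - \<beta>) = ?s"
    by simp
  have "card (X - \<beta>) = d"
    using X \<beta> fin \<open>d \<ge> 1\<close> by (simp add: card_Diff_subset)
  moreover have split: "X - \<beta> = (\<alpha> - \<beta>) \<union> (X - \<beta> - \<alpha>)"
    using \<alpha>(1) by auto
  moreover have "card ((\<alpha> - \<beta>) \<union> (X - \<beta> - \<alpha>)) = card (\<alpha> - \<beta>) + card (X - \<beta> - \<alpha>)"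
    using X(1) fin by (intro card_Un_disjoint) auto
  ultimately have 2: "card (X - \<beta> - \<alpha>) = d - ?s"
    using 1 by simp
  have in1: "weight d (card (insert i \<beta> - \<alpha>)) = weight d ?s" if "i \<in> \<alpha> - \<beta>" for i
    using that by simp
  have in2: "weight d (card (insert i \<beta> - \<alpha>)) = weight d (Suc ?s)" if "i \<in> X - \<beta> - \<alpha>" for i
    using that fin by (simp add: insert_Diff_if)
  have "(\<Sum>i\<in>X - \<beta>. weight d (card (insert i \<beta> - \<alpha>)))
      = (\<Sum>i\<in>\<alpha> - \<beta>. weight d (card (insert i \<beta> - \<alpha>)))
        + (\<Sum>i\<in>X - \<beta> - \<alpha>. weight d (card (insert i \<beta> - \<alpha>)))"
    by (subst split, rule sum.union_disjoint) (use X(1) fin in auto)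
  also have "\<dots> = int ?s * weight d ?s + int (d - ?s) * weight d (Suc ?s)"
    by (simp add: in1 in2 1 2 del: insert_Diff_single)
  also have "\<dots> = (if ?s = 0 then fact d else 0)"
    by (rule weight_cancel[OF s])
  \<comment> \<open>As \<alpha> and \<beta> have equal size, inclusion of \<beta> in \<alpha> forces
    equality.\<close>
  also have "?s = 0 \<longleftrightarrow> \<beta> = \<alpha>"
    using fin \<alpha>(2) \<beta>(2) card_subset_eq[of \<alpha> \<beta>] by auto
  finally show ?thesis .
qed

lemma inclusion_matrix_inverse:
  fixes a :: "'a set \<Rightarrow> 'b::comm_ring_1"
  assumes X: "finite X" "card X = 2 * d - 1" and \<alpha>: "\<alpha> \<subseteq> X" "card \<alpha> = d - 1" and "d \<ge> 1"
  shows "(\<Sum>J | J \<subseteq> X \<and> card J = d. of_int (weight d (card (J - \<alpha>))) * (\<Sum>i\<in>J. a (J - {i})))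
    = of_nat (fact d) * a \<alpha>"
proof -
  let ?S = "\<lambda>k. {J. J \<subseteq> X \<and> card J = k}"
  let ?w = "\<lambda>J. of_int (weight d (card (J - \<alpha>))) :: 'b"
  have finS: "finite (?S k)" for k
    using X(1) by (intro finite_subset[of "?S k" "Pow X"]) auto
  have fin: "finite J" if "J \<subseteq> X" for J
    using that X(1) finite_subset by blast
  have "(\<Sum>J\<in>?S d. ?w J * (\<Sum>i\<in>J. a (J - {i})))
      = (\<Sum>(J, i)\<in>(SIGMA J:?S d. J). ?w J * a (J - {i}))"
    by (subst sum.Sigma[symmetric]) (use finS fin in \<open>auto simp: sum_distrib_left\<close>)
  \<comment> \<open>Exchange of summation: a pair of \<open>J\<close> and \<open>i\<close> in
    \<open>J\<close> is the same as a pair of \<beta> = \<open>J - {i}\<close> and \<open>i\<close>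
    outside \<beta>. This collects the coefficient of each \<open>a \<beta>\<close>.\<close>
  also have "\<dots> = (\<Sum>(\<beta>, i)\<in>(SIGMA \<beta>:?S (d - 1). X - \<beta>). ?w (insert i \<beta>) * a \<beta>)"
    using fin \<open>d \<ge> 1\<close>
    by (intro sum.reindex_bij_witness[where
          i = "\<lambda>(\<beta>, i). (insert i \<beta>, i)" and j = "\<lambda>(J, i). (J - {i}, i)"])
      (auto simp: insert_absorb)
  also have "\<dots> = (\<Sum>\<beta>\<in>?S (d - 1). (\<Sum>i\<in>X - \<beta>. ?w (insert i \<beta>)) * a \<beta>)"
    by (subst sum.Sigma[symmetric]) (use finS X(1) in \<open>auto simp: sum_distrib_right\<close>)
  also have "\<dots> = (\<Sum>\<beta>\<in>?S (d - 1). of_int (if \<beta> = \<alpha> then fact d else 0) * a \<beta>)"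
  proof (rule sum.cong[OF refl])
    fix \<beta> assume "\<beta> \<in> ?S (d - 1)"
    then show "(\<Sum>i\<in>X - \<beta>. ?w (insert i \<beta>)) * a \<beta>
        = of_int (if \<beta> = \<alpha> then fact d else 0) * a \<beta>"
      using sum_weight[OF X \<alpha>, of \<beta>] \<open>d \<ge> 1\<close> by (simp flip: of_int_sum)
  qed
  also have "\<dots> = (\<Sum>\<beta>\<in>?S (d - 1). if \<beta> = \<alpha> then of_nat (fact d) * a \<beta> else 0)"
    using of_int_of_nat_eq[of "fact d", where 'a = 'b] by (intro sum.cong) simp_all
  also have "\<dots> = of_nat (fact d) * a \<alpha>"
    using finS \<alpha> by (simp add: sum.delta)
  finally show ?thesis .
qed

section \<open>Membership in the permanental ideal\<close>

text \<open>The weights carry signs, so multiplying ideal elements by them calls for all integers in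
  the carrier.\<close>

lemma of_int_in_poly_ring: "of_int c \<in> carrier (poly_ring V)"
proof -
  have nat: "of_nat n \<in> carrier (poly_ring V)" for n
    by (induction n) (auto intro: zero_in_poly_ring one_in_poly_ring add_in_poly_ring)
  show ?thesis
    by (cases c) (auto intro: nat uminus_in_poly_ring simp del: of_nat_Suc)
qed

lemma sum_in_poly_ideal:
  assumes "ideal I (poly_ring V)" "\<And>i. i \<in> A \<Longrightarrow> f i \<in> I"
  shows "sum f A \<in> I"
proof -
  have "additive_subgroup I (poly_ring V)"
    using assms(1) by (rule ideal.axioms(1))
  then have "0 \<in> I" "\<And>x y. x \<in> I \<Longrightarrow> y \<in> I \<Longrightarrow> x + y \<in> I"
    using additive_subgroup.zero_closed additive_subgroup.a_closed by fastforce+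
  with assms(2) show ?thesis
    by (induction A rule: infinite_finite_induct) auto
qed

lemma permanent_eq_set_permanent_generic:
  assumes "I \<subseteq> {..<m}" "J \<subseteq> {..<n}" "card I = card J"
  shows "permanent (submatrix (generic_mat m n) I J) = set_permanent I J (\<lambda>i j. var (i, j))"
proof -
  have "permanent (submatrix (generic_mat m n) I J)
      = set_permanent I J (\<lambda>i j. generic_mat m n $$ (i, j))"
    using assms by (intro permanent_submatrix) (simp_all add: generic_mat_def)
  also have "\<dots> = set_permanent I J (\<lambda>i j. var (i, j))"
    unfolding set_permanent_def
  proof (intro sum.cong prod.cong refl)
    fix g i assume "g \<in> bijections I J" "i \<in> I"
    then have "i < m" "g i < n"
      using assms by (auto simp: bijections_def dest: bij_betwE)
    then show "generic_mat m n $$ (i, g i) = var (i, g i)"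
      by (simp add: generic_mat_def)
  qed
  finally show ?thesis .
qed

text \<open>Expansion along row 0 pairs the minor on \<open>J - {i}\<close> with
  \<open>var (0, i)\<close>, which is just the factor that the product over the complement of
  \<open>J\<close> lacks for \<open>A'_poly d (J - {i})\<close>.\<close>

lemma laplace_A':
  assumes "d \<ge> 1" "J \<subseteq> {..<2 * d - 1}" "card J = d"
  shows "permanent (submatrix (generic_mat d (2 * d - 1)) {..<d} J)
      * (\<Prod>i\<in>{..<2 * d - 1} - J. var (0, i))
    = (\<Sum>i\<in>J. A'_poly d (J - {i}) :: (nat \<times> nat, 'k::comm_ring_1) mpoly)"
proof -
  let ?X = "{..<2 * d - 1}"
  have fin: "finite J"
    using assms(2) finite_subset by blast
  have rows: "{..<d} = insert 0 {1..<d}"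
    using assms(1) by auto
  have "(permanent (submatrix (generic_mat d (2 * d - 1)) {..<d} J) :: (nat \<times> nat, 'k) mpoly)
      = (\<Sum>i\<in>J. var (0, i) * set_permanent {1..<d} (J - {i}) (\<lambda>i j. var (i, j)))"
    using assms fin
    by (subst permanent_eq_set_permanent_generic) (simp_all add: rows set_permanent_insert)
  also have "\<dots> * (\<Prod>i\<in>?X - J. var (0, i)) = (\<Sum>i\<in>J. A'_poly d (J - {i}))"
    unfolding sum_distrib_right
  proof (rule sum.cong[OF refl])
    fix i assume i: "i \<in> J"
    have "(A_poly d (J - {i}) :: (nat \<times> nat, 'k) mpoly)
        = set_permanent {1..<d} (J - {i}) (\<lambda>i j. var (i, j))"
      unfolding A_poly_def
      using assms fin i by (intro permanent_eq_set_permanent_generic) auto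
    moreover have "?X - (J - {i}) = insert i (?X - J)"
      using i assms(2) by auto
    ultimately show "var (0, i) * set_permanent {1..<d} (J - {i}) (\<lambda>i j. var (i, j))
        * (\<Prod>i\<in>?X - J. var (0, i)) = (A'_poly d (J - {i}) :: (nat \<times> nat, 'k) mpoly)"
      using i by (simp add: A'_poly_def mult_ac)
  qed
  finally show ?thesis .
qed

theorem proposition5:
  fixes d :: nat and \<alpha> :: "nat set"
  assumes "d \<ge> 1"
    and "\<alpha> \<subseteq> {..<2 * d - 1}"
    and "card \<alpha> = d - 1"
  shows "of_nat (fact d) * A'_poly d \<alpha>
    \<in> (permanental_ideal d d (2 * d - 1) :: (nat \<times> nat, 'k::field) mpoly set)"
proof -
  let ?X = "{..<2 * d - 1}"
  let ?R = "generic_ring d (2 * d - 1) :: (nat \<times> nat, 'k) mpoly ring"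
  let ?I = "permanental_ideal d d (2 * d - 1) :: (nat \<times> nat, 'k) mpoly set"
  interpret ideal ?I ?R
    by (rule ideal_permanental_ideal)
  have "of_int (weight d (card (J - \<alpha>))) * (\<Sum>i\<in>J. A'_poly d (J - {i}))
      \<in> ?I" if J: "J \<subseteq> ?X" "card J = d" for J
  proof -
    let ?P = "permanent (submatrix (generic_mat d (2 * d - 1)) {..<d} J)
      :: (nat \<times> nat, 'k) mpoly"
    have "?P \<in> subpermanents d d (2 * d - 1)"
      unfolding subpermanents_def using J
      by (intro CollectI exI[of _ "{..<d}"] exI[of _ J]) simp
    then have "?P \<in> ?I"
      unfolding permanental_ideal_def using genideal_self[OF subpermanents_subset] by blast
    \<comment> \<open>Row 0 exists because d \<ge> 1, so these indeterminates belong to the ring and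
      the ideal absorbs their product.\<close>
    moreover have "(\<Prod>i\<in>?X - J. var (0, i)) \<in> carrier ?R"
      using assms(1) by (intro prod_in_poly_ring var_in_poly_ring) auto
    ultimately have "?P * (\<Prod>i\<in>?X - J. var (0, i)) \<in> ?I"
      using I_r_closed by simp
    then show ?thesis
      using I_l_closed[OF _ of_int_in_poly_ring] laplace_A'[OF assms(1) J, where 'k = 'k] by simp
  qed
  then have "(\<Sum>J | J \<subseteq> ?X \<and> card J = d.
      of_int (weight d (card (J - \<alpha>))) * (\<Sum>i\<in>J. A'_poly d (J - {i}))) \<in> ?I"
    by (intro sum_in_poly_ideal[OF ideal_permanental_ideal]) auto
  \<comment> \<open>The weighted sum just placed in the ideal collapses to d! times the single term
    at \<alpha>.\<close>
  then show ?thesis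
    using inclusion_matrix_inverse[of ?X d \<alpha> "A'_poly d :: _ \<Rightarrow> (_, 'k) mpoly"] assms
    by simp
qed

end
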